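(* Let $(X,d)$ be a compact metric space that admits, for each $\epsilon>0$, a retraction $r_\epsilon:X\to Y_\epsilon$ onto a subspace $Y_\epsilon=r_\epsilon(X)\subset X$ such that $\hat d(r_\epsilon,\mathrm{id}_X)<\epsilon$ and $Y_\epsilon\in\mu CR$. Then $X\in\mu CR$.
   Context: For a compact metric space $(X,d)$, $C(X,X)$ is the space of continuous self-maps of $X$ with the topology of uniform convergence, and $\hat d(f,g)=\sup_x d(f(x),g(x))$. A retraction onto a subspace $Y\subset X$ is a continuous map $r:X\to Y$ with $r(y)=y$ for all $y\in Y$. For $f\in C(X,X)$ and $\epsilon>0$, an $\epsilon$-chain for $f$ from $x$ to $y$ is a finite sequence $x=x_0,x_1,\dots,x_n=y$ ($n\ge 1$) in $X$ with $d(f(x_{i-1}),x_i)<\epsilon$ for $i=1,\dots,n$. A point $x$ is chain recurrent for $f$ if for each $\epsilon>0$ there is an $\epsilon$-chain for $f$ from $x$ to $x$; $CR(f)$ is the set of chain recurrent points of $f$. $\mu CR$ is the class of compact metric spaces $X$ such that for any finite, atom-less, Borel measure $\mu$ on $X$ the set $\{f\in C(X,X):\mu(CR(f))=0\}$ is a dense $G_\delta$-subset of $C(X,X)$. *)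

theory Defs
  imports "HOL-Analysis.Analysis"
begin

text \<open>
  For compact \<open>m\<close> every continuous function is bounded, so this is the space of all
  continuous self-maps of \<open>m\<close> with the metric \<open>SUP x. mdist m (f x) (g x)\<close> (and distance 0
  on the one-point space of self-maps of the empty space). Its elements are extensional:
  they take the value \<open>undefined\<close> outside the carrier, so each self-map has one representative.
\<close>
abbreviation self_maps :: "'a metric \<Rightarrow> ('a \<Rightarrow> 'a) metric" where
  "self_maps m \<equiv> cfunspace (mtopology_of m) m"

definition eps_chain :: "'a metric \<Rightarrow> ('a \<Rightarrow> 'a) \<Rightarrow> real \<Rightarrow> 'a \<Rightarrow> 'a \<Rightarrow> bool" where
  "eps_chain m f \<epsilon> x y \<longleftrightarrow>
     (\<exists>(n::nat) xs. n \<ge> 1 \<and> xs 0 = x \<and> xs n = y \<and> (\<forall>i\<le>n. xs i \<in> mspace m) \<and>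
        (\<forall>i\<in>{1..n}. mdist m (f (xs (i - 1))) (xs i) < \<epsilon>))"

definition chain_recurrent_set :: "'a metric \<Rightarrow> ('a \<Rightarrow> 'a) \<Rightarrow> 'a set" where
  "chain_recurrent_set m f = {x \<in> mspace m. \<forall>\<epsilon>>0. eps_chain m f \<epsilon> x x}"

text \<open>An equality of \<open>sets\<close> also determines \<open>space\<close>: here \<open>space M = mspace m\<close>.\<close>
definition finite_borel_measure_on :: "'a metric \<Rightarrow> 'a measure \<Rightarrow> bool" where
  "finite_borel_measure_on m M \<longleftrightarrow>
     finite_measure M \<and> sets M = sigma_sets (mspace m) {U. openin (mtopology_of m) U}"

definition measure_atom :: "'a measure \<Rightarrow> 'a set \<Rightarrow> bool" where
  "measure_atom M A \<longleftrightarrow> A \<in> sets M \<and> emeasure M A > 0 \<and>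
     (\<forall>B\<in>sets M. B \<subseteq> A \<and> emeasure M B < emeasure M A \<longrightarrow> emeasure M B = 0)"

definition atomless :: "'a measure \<Rightarrow> bool" where
  "atomless M \<longleftrightarrow> (\<nexists>A. measure_atom M A)"

text \<open>
  Membership in \<open>null_sets M\<close> is \<open>emeasure M A = 0\<close> together with measurability of \<open>A\<close>;
  a bare \<open>emeasure M A = 0\<close> would also hold for every non-measurable \<open>A\<close>.
\<close>
definition muCR :: "'a metric \<Rightarrow> bool" where
  "muCR m \<longleftrightarrow> compact_space (mtopology_of m) \<and>
     (\<forall>M. finite_borel_measure_on m M \<and> atomless M \<longrightarrow>
        (let C = mtopology_of (self_maps m);
             G = {f \<in> mspace (self_maps m). chain_recurrent_set m f \<in> null_sets M}
         in gdelta_in C G \<and> C closure_of G = topspace C))"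

definition retraction_onto :: "'a metric \<Rightarrow> 'a set \<Rightarrow> ('a \<Rightarrow> 'a) \<Rightarrow> bool" where
  "retraction_onto m Y r \<longleftrightarrow> Y \<subseteq> mspace m \<and>
     continuous_map (mtopology_of m) (mtopology_of (submetric m Y)) r \<and> (\<forall>y\<in>Y. r y = y)"

end

theory Submission
  imports Defs
begin

text \<open>
  The \<open>G\<^sub>\<delta>\<close> part comes from semicontinuity. The chain recurrent set of \<open>f\<close> is the decreasing
  intersection, over \<open>\<epsilon>\<close>, of the open sets of points lying on \<open>\<epsilon>\<close>-loops, so it is null for a finite
  measure iff the loop sets have arbitrarily small measure (\<open>chain_recurrent_set_null_iff\<close>). A map
  uniformly close to \<open>f\<close> has its shorter loops among the loops of \<open>f\<close>, so each single bound
  \<open>1 / Suc k\<close> defines an open set of maps (\<open>gdelta_in_chain_recurrent_null\<close>).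

  Density is where the retractions enter. Given \<open>f\<close> and a measure \<open>M\<close>, take a retraction \<open>r\<close> onto \<open>Y\<close>
  close to the identity. The restriction of \<open>M\<close> to \<open>Y\<close> is again atomless, so the self-map
  \<open>r \<circ> f\<close> of \<open>Y\<close> is uniformly approximated by self-maps \<open>k\<close> of \<open>Y\<close> with null chain recurrent set.
  The map \<open>k \<circ> r\<close> is then close to \<open>r \<circ> f \<circ> r\<close> and hence to \<open>f\<close>. Its chains are pushed into \<open>Y\<close>
  by \<open>r\<close>, where they become chains for \<open>k\<close>; thus all its chain recurrent points are chain recurrent
  for \<open>k\<close> (\<open>chain_recurrent_set_comp_retraction\<close>) and form an \<open>M\<close>-null set.
\<close>

section \<open>Perturbing chains\<close>

lemma mtopology_of_eq: "mtopology_of m = Metric_space.mtopology (mspace m) (mdist m)"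
  by (simp add: mtopology_of_def)

lemma uniformly_continuous_mapE:
  assumes "uniformly_continuous_map m1 m2 f" "\<epsilon> > 0"
  obtains \<delta> where "\<delta> > 0"
    "\<forall>a\<in>mspace m1. \<forall>b\<in>mspace m1. mdist m1 a b < \<delta> \<longrightarrow> mdist m2 (f a) (f b) < \<epsilon>"
  using assms unfolding uniformly_continuous_map_def by metis

definition chain_loops :: "'a metric \<Rightarrow> ('a \<Rightarrow> 'a) \<Rightarrow> real \<Rightarrow> 'a set" where
  "chain_loops m f \<epsilon> = {x \<in> mspace m. eps_chain m f \<epsilon> x x}"

lemma eps_chainE:
  assumes "eps_chain m f \<epsilon> x y"
  obtains n xs where "n \<ge> (1::nat)" "xs 0 = x" "xs n = y" "\<forall>i\<le>n. xs i \<in> mspace m"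
    "\<forall>i\<in>{1..n}. mdist m (f (xs (i - 1))) (xs i) < \<epsilon>"
  using assms unfolding eps_chain_def by blast

lemma eps_chain_mono:
  assumes "eps_chain m f \<epsilon> x y" "\<epsilon> \<le> \<epsilon>'"
  shows "eps_chain m f \<epsilon>' x y"
  using assms unfolding eps_chain_def by fastforce

lemma chain_loops_mono: "\<epsilon> \<le> \<epsilon>' \<Longrightarrow> chain_loops m f \<epsilon> \<subseteq> chain_loops m f \<epsilon>'"
  using eps_chain_mono by (auto simp: chain_loops_def)

lemma eps_chain_perturb_map:
  assumes chain: "eps_chain m f \<epsilon> x y"
    and f: "f \<in> mspace m \<rightarrow> mspace m" and g: "g \<in> mspace m \<rightarrow> mspace m"
    and close: "\<And>z. z \<in> mspace m \<Longrightarrow> mdist m (g z) (f z) \<le> \<delta>"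
  shows "eps_chain m g (\<epsilon> + \<delta>) x y"
proof -
  obtain n xs where n: "n \<ge> (1::nat)" "xs 0 = x" "xs n = y" and xs0: "\<forall>i\<le>n. xs i \<in> mspace m"
    and d0: "\<forall>i\<in>{1..n}. mdist m (f (xs (i - 1))) (xs i) < \<epsilon>"
    using chain by (rule eps_chainE)
  note xs = xs0[rule_format] and d = d0[rule_format]
  have "mdist m (g (xs (i - 1))) (xs i) < \<epsilon> + \<delta>" if "i \<in> {1..n}" for i
  proof -
    have in_m: "xs (i - 1) \<in> mspace m" "xs i \<in> mspace m"
      using xs that by auto
    then have "mdist m (g (xs (i - 1))) (xs i)
        \<le> mdist m (g (xs (i - 1))) (f (xs (i - 1))) + mdist m (f (xs (i - 1))) (xs i)"
      using f g by (intro mdist_triangle) auto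
    then show ?thesis
      using close[OF in_m(1)] d[OF that] by linarith
  qed
  then show ?thesis
    using n xs unfolding eps_chain_def by blast
qed

text \<open>
  A loop has finitely many jumps, each strictly shorter than \<open>\<epsilon>\<close>, so there is a common slack
  \<open>\<eta>\<close>. It is used up by moving the base point, which enters as the argument of \<open>f\<close> in the first
  jump and as the target of the last one; when the loop has length one both happen in the same jump.
\<close>
lemma openin_chain_loops:
  assumes f: "continuous_map (mtopology_of m) (mtopology_of m) f"
  shows "openin (mtopology_of m) (chain_loops m f \<epsilon>)"
proof -
  interpret Metric_space "mspace m" "mdist m" by simp
  have fim: "f \<in> mspace m \<rightarrow> mspace m"
    using continuous_map_funspace[OF f] by simp
  have "\<exists>\<delta>>0. mball x \<delta> \<subseteq> chain_loops m f \<epsilon>" if x: "x \<in> chain_loops m f \<epsilon>" for x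
  proof -
    have "eps_chain m f \<epsilon> x x"
      using x by (simp add: chain_loops_def)
    then obtain n xs where n: "n \<ge> (1::nat)" "xs 0 = x" "xs n = x" and xs0: "\<forall>i\<le>n. xs i \<in> mspace m"
      and d0: "\<forall>i\<in>{1..n}. mdist m (f (xs (i - 1))) (xs i) < \<epsilon>"
      by (rule eps_chainE)
    note xs = xs0[rule_format] and d = d0[rule_format]
    have xm: "x \<in> mspace m"
      using x by (simp add: chain_loops_def)
    define \<eta> where "\<eta> = Min ((\<lambda>i. \<epsilon> - mdist m (f (xs (i - 1))) (xs i)) ` {1..n})"
    have "\<eta> > 0"
      using d n(1) by (auto simp: \<eta>_def)
    have slack: "mdist m (f (xs (i - 1))) (xs i) \<le> \<epsilon> - \<eta>" if "i \<in> {1..n}" for i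
    proof -
      have "\<eta> \<le> \<epsilon> - mdist m (f (xs (i - 1))) (xs i)"
        unfolding \<eta>_def using that by (intro Min_le) auto
      then show ?thesis by linarith
    qed
    obtain \<delta> where "\<delta> > 0"
      and \<delta>: "\<And>z. z \<in> mspace m \<Longrightarrow> mdist m x z < \<delta> \<Longrightarrow> mdist m (f x) (f z) < \<eta>/2"
      using f xm \<open>\<eta> > 0\<close> unfolding mtopology_of_def metric_continuous_map[OF Metric_space_axioms]
      by (meson half_gt_zero)
    have "eps_chain m f \<epsilon> z z" if z: "z \<in> mspace m" "mdist m x z < min \<delta> (\<eta>/2)" for z
    proof -
      define zs where "zs = xs(0 := z, n := z)"
      have zs: "zs i \<in> mspace m" if "i \<le> n" for i
        using that xs z by (auto simp: zs_def)
      have arg: "mdist m (f (zs i)) (f (xs i)) < \<eta>/2" if "i \<le> n" for i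
      proof (cases "i = 0 \<or> i = n")
        case True
        then have "zs i = z" "xs i = x"
          using n by (auto simp: zs_def)
        then show ?thesis
          using \<delta>[of z] z by (simp add: mdist_commute)
      next
        case False
        then have "zs i = xs i" by (auto simp: zs_def)
        moreover have "f (xs i) \<in> mspace m"
          using fim xs that by blast
        ultimately show ?thesis
          using \<open>\<eta> > 0\<close> by simp
      qed
      have target: "mdist m (xs i) (zs i) < \<eta>/2" if "i \<le> n" for i
        using that n z xs \<open>\<eta> > 0\<close> by (auto simp: zs_def)
      have "mdist m (f (zs (i - 1))) (zs i) < \<epsilon>" if i: "i \<in> {1..n}" for i
      proof -
        have le: "i - 1 \<le> n" "i \<le> n" using i by auto
        have im: "f (zs (i - 1)) \<in> mspace m" "f (xs (i - 1)) \<in> mspace m"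
          using fim zs[OF le(1)] xs[OF le(1)] by auto
        have "mdist m (f (zs (i - 1))) (zs i)
            \<le> mdist m (f (zs (i - 1))) (f (xs (i - 1))) + mdist m (f (xs (i - 1))) (zs i)"
          using im zs[OF le(2)] by (intro mdist_triangle) auto
        moreover have "mdist m (f (xs (i - 1))) (zs i)
            \<le> mdist m (f (xs (i - 1))) (xs i) + mdist m (xs i) (zs i)"
          using im zs[OF le(2)] xs[OF le(2)] by (intro mdist_triangle) auto
        ultimately show ?thesis
          using arg[OF le(1)] target[OF le(2)] slack[OF i] by linarith
      qed
      moreover have "zs 0 = z" "zs n = z"
        by (auto simp: zs_def)
      ultimately show ?thesis
        unfolding eps_chain_def using n(1) zs by blast
    qed
    then have "mball x (min \<delta> (\<eta>/2)) \<subseteq> chain_loops m f \<epsilon>"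
      by (auto simp: chain_loops_def)
    then show ?thesis
      using \<open>\<delta> > 0\<close> \<open>\<eta> > 0\<close> by (metis half_gt_zero min_less_iff_conj)
  qed
  then show ?thesis
    unfolding mtopology_of_def openin_mtopology by (auto simp: chain_loops_def)
qed

lemma chain_recurrent_set_eq_INT:
  "chain_recurrent_set m f = (\<Inter>n. chain_loops m f (1 / Suc n))"
proof (intro equalityI subsetI)
  fix x assume "x \<in> chain_recurrent_set m f"
  then show "x \<in> (\<Inter>n. chain_loops m f (1 / Suc n))"
    by (auto simp: chain_recurrent_set_def chain_loops_def)
next
  fix x assume x: "x \<in> (\<Inter>n. chain_loops m f (1 / Suc n))"
  have "eps_chain m f \<epsilon> x x" if "\<epsilon> > 0" for \<epsilon>
  proof -
    obtain n where "1 / Suc n < \<epsilon>"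
      using \<open>\<epsilon> > 0\<close> by (rule nat_approx_posE)
    moreover have "eps_chain m f (1 / Suc n) x x"
      using x by (auto simp: chain_loops_def)
    ultimately show ?thesis
      using eps_chain_mono by (metis less_imp_le)
  qed
  then show "x \<in> chain_recurrent_set m f"
    using x by (auto simp: chain_recurrent_set_def chain_loops_def)
qed

lemma decseq_chain_loops: "decseq (\<lambda>n. chain_loops m f (1 / Suc n))"
  by (intro decseq_SucI chain_loops_mono) (simp add: field_simps)

section \<open>Maps with a null chain recurrent set\<close>

lemma sets_of_openin:
  assumes "finite_borel_measure_on m M" "openin (mtopology_of m) U"
  shows "U \<in> sets M"
  using assms by (auto simp: finite_borel_measure_on_def)

lemma sets_of_closedin:
  assumes M: "finite_borel_measure_on m M" and Y: "closedin (mtopology_of m) Y"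
  shows "Y \<in> sets M"
proof -
  have "mspace m \<in> sets M" "mspace m - Y \<in> sets M"
    using sets_of_openin[OF M] Y openin_topspace[of "mtopology_of m"] by (auto simp: closedin_def)
  then have "mspace m - (mspace m - Y) \<in> sets M"
    by blast
  moreover have "mspace m - (mspace m - Y) = Y"
    using closedin_subset[OF Y] by auto
  ultimately show ?thesis by simp
qed

text \<open>
  Continuity of a finite measure from above along the decreasing open sets of loops turns the
  condition on the intersection into conditions on single \<open>\<epsilon>\<close>, and those survive small
  perturbations of the map.
\<close>
lemma chain_recurrent_set_null_iff:
  assumes M: "finite_borel_measure_on m M"
    and f: "continuous_map (mtopology_of m) (mtopology_of m) f"
  shows "chain_recurrent_set m f \<in> null_sets M \<longleftrightarrow>
    (\<forall>k. \<exists>\<epsilon>>0. measure M (chain_loops m f \<epsilon>) < 1 / Suc k)"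
proof -
  interpret finite_measure M
    using M by (simp add: finite_borel_measure_on_def)
  have loops: "chain_loops m f \<epsilon> \<in> sets M" for \<epsilon>
    by (intro sets_of_openin[OF M] openin_chain_loops f)
  have CR: "chain_recurrent_set m f \<in> sets M"
    unfolding chain_recurrent_set_eq_INT using loops by auto
  have null: "chain_recurrent_set m f \<in> null_sets M \<longleftrightarrow> measure M (chain_recurrent_set m f) = 0"
    using CR by (auto simp: null_sets_def emeasure_eq_measure)
  have lim: "(\<lambda>n. measure M (chain_loops m f (1 / Suc n))) \<longlonglongrightarrow> measure M (chain_recurrent_set m f)"
    unfolding chain_recurrent_set_eq_INT
    by (rule finite_Lim_measure_decseq) (use loops decseq_chain_loops in auto)
  show ?thesis
  proof
    assume "chain_recurrent_set m f \<in> null_sets M"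
    then have lim0: "(\<lambda>n. measure M (chain_loops m f (1 / Suc n))) \<longlonglongrightarrow> 0"
      using lim null by simp
    have "\<exists>n. measure M (chain_loops m f (1 / Suc n)) < 1 / Suc k" for k
      using order_tendstoD(2)[OF lim0, of "1 / Suc k"] eventually_happens[of _ sequentially] by auto
    then show "\<forall>k. \<exists>\<epsilon>>0. measure M (chain_loops m f \<epsilon>) < 1 / Suc k"
      by (metis of_nat_0_less_iff zero_less_Suc zero_less_divide_1_iff)
  next
    assume small: "\<forall>k. \<exists>\<epsilon>>0. measure M (chain_loops m f \<epsilon>) < 1 / Suc k"
    have "measure M (chain_recurrent_set m f) \<le> 1 / Suc k" for k
    proof -
      obtain \<epsilon> where "\<epsilon> > 0" and \<epsilon>: "measure M (chain_loops m f \<epsilon>) < 1 / Suc k"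
        using small by blast
      have "chain_recurrent_set m f \<subseteq> chain_loops m f \<epsilon>"
        using \<open>\<epsilon> > 0\<close> by (auto simp: chain_recurrent_set_def chain_loops_def)
      then have "measure M (chain_recurrent_set m f) \<le> measure M (chain_loops m f \<epsilon>)"
        using loops by (intro finite_measure_mono) auto
      then show ?thesis using \<epsilon> by linarith
    qed
    then have "measure M (chain_recurrent_set m f) \<le> 0"
      using nat_approx_posE by (meson leD leI order_le_less_trans)
    then show "chain_recurrent_set m f \<in> null_sets M"
      using null measure_nonneg[of M] by (simp add: order_antisym)
  qed
qed

text \<open>
  If \<open>g\<close> is within \<open>\<epsilon>/2\<close> of \<open>f\<close>, then the \<open>\<epsilon>/2\<close>-loops of \<open>g\<close> are \<open>\<epsilon>\<close>-loops of \<open>f\<close>, so a bound on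
  the measure of the latter also bounds that of the former. The sets \<open>U k\<close> below are therefore open.
\<close>
lemma gdelta_in_chain_recurrent_null:
  assumes M: "finite_borel_measure_on m M"
  shows "gdelta_in (mtopology_of (self_maps m))
    {f \<in> mspace (self_maps m). chain_recurrent_set m f \<in> null_sets M}"
proof -
  interpret finite_measure M
    using M by (simp add: finite_borel_measure_on_def)
  interpret C: Metric_space "mspace (self_maps m)" "mdist (self_maps m)"
    by blast
  define U where "U k = {f \<in> mspace (self_maps m).
      \<exists>\<epsilon>>0. measure M (chain_loops m f \<epsilon>) < 1 / Suc k}" for k :: nat
  have cont: "continuous_map (mtopology_of m) (mtopology_of m) f" and
       maps: "f \<in> mspace m \<rightarrow> mspace m" if "f \<in> mspace (self_maps m)" for f
    using that by auto
  have "openin (mtopology_of (self_maps m)) (U k)" for k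
  proof -
    have "\<exists>\<rho>>0. C.mball f \<rho> \<subseteq> U k" if "f \<in> U k" for f
    proof -
      obtain \<epsilon> where "\<epsilon> > 0" and \<epsilon>: "measure M (chain_loops m f \<epsilon>) < 1 / Suc k"
        and f: "f \<in> mspace (self_maps m)"
        using \<open>f \<in> U k\<close> by (auto simp only: U_def mem_Collect_eq)
      have "g \<in> U k" if g: "g \<in> mspace (self_maps m)" and fg: "mdist (self_maps m) f g < \<epsilon>/2" for g
      proof -
        have "mdist m (f z) (g z) \<le> \<epsilon>/2" if "z \<in> mspace m" for z
          using mdist_cfunspace_imp_mdist_le[OF f g less_imp_le[OF fg]] that by simp
        then have "chain_loops m g (\<epsilon>/2) \<subseteq> chain_loops m f \<epsilon>"
          using eps_chain_perturb_map[OF _ maps[OF g] maps[OF f], of "\<epsilon>/2" _ _ "\<epsilon>/2"]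
          by (auto simp: chain_loops_def)
        then have "measure M (chain_loops m g (\<epsilon>/2)) \<le> measure M (chain_loops m f \<epsilon>)"
          by (intro finite_measure_mono sets_of_openin[OF M] openin_chain_loops cont f)
        then have "measure M (chain_loops m g (\<epsilon>/2)) < 1 / Suc k"
          using \<epsilon> by linarith
        then show ?thesis
          unfolding U_def using g \<open>\<epsilon> > 0\<close> half_gt_zero by blast
      qed
      then have "C.mball f (\<epsilon>/2) \<subseteq> U k"
        unfolding C.mball_def by blast
      then show ?thesis
        using \<open>\<epsilon> > 0\<close> half_gt_zero by blast
    qed
    then show ?thesis
      unfolding mtopology_of_eq[of "self_maps m"] C.openin_mtopology U_def by blast
  qed
  then have "gdelta_in (mtopology_of (self_maps m)) (\<Inter>(range U))"
    by (intro gdelta_in_Inter) (auto intro: open_imp_gdelta_in)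
  moreover have "\<Inter>(range U) = {f \<in> mspace (self_maps m). chain_recurrent_set m f \<in> null_sets M}"
    using chain_recurrent_set_null_iff[OF M cont] unfolding U_def by blast
  ultimately show ?thesis by simp
qed

section \<open>Restricting a measure to a closed subspace\<close>

lemma finite_borel_measure_on_restrict_space:
  assumes M: "finite_borel_measure_on m M" and Y: "closedin (mtopology_of m) Y"
  shows "finite_borel_measure_on (submetric m Y) (restrict_space M Y)"
proof -
  have Ym: "Y \<subseteq> mspace m"
    using closedin_subset[OF Y] by simp
  have sets_M: "sets M = sigma_sets (mspace m) {U. openin (mtopology_of m) U}"
    and fin: "finite_measure M"
    using M by (auto simp: finite_borel_measure_on_def)
  have "(\<inter>) Y ` {U. openin (mtopology_of m) U} = {V. openin (mtopology_of (submetric m Y)) V}"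
    by (auto simp: mtopology_of_submetric openin_subtopology Int_commute)
  then have "sets (restrict_space M Y) = sigma_sets Y {V. openin (mtopology_of (submetric m Y)) V}"
    using sigma_sets_Int[of Y "mspace m"] sets_of_closedin[OF M Y] Ym
    by (simp add: sets_restrict_space sets_M)
  moreover have "mspace (submetric m Y) = Y"
    using Ym by auto
  ultimately show ?thesis
    using finite_measure_restrict_space[OF fin sets_of_closedin[OF M Y]]
    by (simp add: finite_borel_measure_on_def)
qed

text \<open>An atom of the restriction is already an atom of \<open>M\<close>, because it has the same measurable subsets.\<close>
lemma atomless_restrict_space:
  assumes "atomless M" and Y: "Y \<in> sets M"
  shows "atomless (restrict_space M Y)"
proof -
  have YM: "Y \<inter> space M \<in> sets M"
    using Y by auto
  have "measure_atom M A" if A: "measure_atom (restrict_space M Y) A" for A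
  proof -
    have AY: "A \<subseteq> Y" "A \<in> sets M"
      using A by (auto simp: measure_atom_def sets_restrict_space_iff[OF YM])
    have em: "emeasure (restrict_space M Y) B = emeasure M B" if "B \<subseteq> A" for B
      using that AY by (intro emeasure_restrict_space YM) auto
    have "emeasure M B = 0" if "B \<in> sets M" "B \<subseteq> A" "emeasure M B < emeasure M A" for B
      using A that AY em[of B] em[of A]
      by (auto simp: measure_atom_def sets_restrict_space_iff[OF YM])
    then show ?thesis
      using A AY em[of A] by (auto simp: measure_atom_def)
  qed
  then show ?thesis
    using assms(1) by (auto simp: atomless_def)
qed

section \<open>Lifting self-maps along a retraction\<close>

text \<open>
  Values of \<open>f \<circ> r\<close> lie in \<open>Y\<close>, so recurrent points are limits of points of \<open>Y\<close> and are
  fixed by \<open>r\<close>. Applying \<open>r\<close> to a chain for \<open>f \<circ> r\<close> gives a chain for \<open>f\<close> inside \<open>Y\<close>: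
  \<open>r\<close> leaves the values of \<open>f \<circ> r\<close> in place, and by uniform continuity it moves the jumps
  to jumps that are still small.
\<close>
lemma chain_recurrent_set_comp_retraction:
  assumes r: "uniformly_continuous_map m m r" and rY: "r \<in> mspace m \<rightarrow> Y"
    and fix_Y: "\<And>y. y \<in> Y \<Longrightarrow> r y = y"
    and Y: "closedin (mtopology_of m) Y"
    and f: "f \<in> Y \<rightarrow> Y"
    and g: "\<And>x. x \<in> mspace m \<Longrightarrow> g x = f (r x)"
  shows "chain_recurrent_set m g \<subseteq> chain_recurrent_set (submetric m Y) f"
proof
  interpret Metric_space "mspace m" "mdist m" by simp
  fix x assume x: "x \<in> chain_recurrent_set m g"
  then have xm: "x \<in> mspace m" and loop: "\<And>\<epsilon>. \<epsilon> > 0 \<Longrightarrow> eps_chain m g \<epsilon> x x"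
    by (auto simp: chain_recurrent_set_def)
  have Ym: "Y \<subseteq> mspace m"
    using closedin_subset[OF Y] by simp
  have gY: "g z \<in> Y" if "z \<in> mspace m" for z
    using that g rY f by (metis Pi_mem)
  have "\<exists>y\<in>Y. y \<in> mball x \<epsilon>" if "\<epsilon> > 0" for \<epsilon>
  proof -
    obtain n xs where n: "n \<ge> (1::nat)" "xs 0 = x" "xs n = x" and xs0: "\<forall>i\<le>n. xs i \<in> mspace m"
      and d0: "\<forall>i\<in>{1..n}. mdist m (g (xs (i - 1))) (xs i) < \<epsilon>"
      using loop[OF \<open>\<epsilon> > 0\<close>] by (rule eps_chainE)
    note xs = xs0[rule_format] and d = d0[rule_format]
    have "g (xs (n - 1)) \<in> Y"
      using gY xs by simp
    moreover have "mdist m x (g (xs (n - 1))) < \<epsilon>"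
      using d[of n] n by (simp add: mdist_commute)
    ultimately show ?thesis
      using xm Ym by auto
  qed
  then have "x \<in> mtopology_of m closure_of Y"
    using xm unfolding mtopology_of_def metric_closure_of by blast
  then have xY: "x \<in> Y"
    using Y by (simp add: closure_of_closedin)
  have "eps_chain (submetric m Y) f \<epsilon> x x" if "\<epsilon> > 0" for \<epsilon>
  proof -
    obtain \<delta> where "\<delta> > 0" and \<delta>0: "\<forall>a\<in>mspace m. \<forall>b\<in>mspace m.
        mdist m a b < \<delta> \<longrightarrow> mdist m (r a) (r b) < \<epsilon>"
      using r \<open>\<epsilon> > 0\<close> by (rule uniformly_continuous_mapE)
    note \<delta> = \<delta>0[rule_format]
    obtain n xs where n: "n \<ge> (1::nat)" "xs 0 = x" "xs n = x"
      and xs0: "\<forall>i\<le>n. xs i \<in> mspace m"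
      and d0: "\<forall>i\<in>{1..n}. mdist m (g (xs (i - 1))) (xs i) < \<delta>"
      using loop[OF \<open>\<delta> > 0\<close>] by (rule eps_chainE)
    note xs = xs0[rule_format] and d = d0[rule_format]
    have "mdist m (f (r (xs (i - 1)))) (r (xs i)) < \<epsilon>" if i: "i \<in> {1..n}" for i
    proof -
      have le: "xs (i - 1) \<in> mspace m" "xs i \<in> mspace m"
        using i xs by auto
      have "mdist m (r (g (xs (i - 1)))) (r (xs i)) < \<epsilon>"
        using \<delta> gY[OF le(1)] Ym le(2) d[OF i] by blast
      then show ?thesis
        using fix_Y[OF gY[OF le(1)]] g[OF le(1)] by simp
    qed
    moreover have "r (xs i) \<in> mspace (submetric m Y)" if "i \<le> n" for i
      using xs[OF that] rY Ym by auto
    moreover have "r (xs 0) = x" "r (xs n) = x"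
      using n fix_Y xY by auto
    ultimately show ?thesis
      unfolding eps_chain_def using n(1) by (intro exI[of _ n] exI[of _ "r \<circ> xs"]) simp
  qed
  then show "x \<in> chain_recurrent_set (submetric m Y) f"
    using xY xm by (simp add: chain_recurrent_set_def)
qed

theorem theorem7p3:
  fixes m :: "'a metric"
  assumes "compact_space (mtopology_of m)"
    and "\<And>\<epsilon>::real. \<epsilon> > 0 \<Longrightarrow> \<exists>Y r. retraction_onto m Y r \<and> Y = r ` mspace m \<and>
           mdist (self_maps m) (restrict r (mspace m)) (restrict id (mspace m)) < \<epsilon> \<and>
           muCR (submetric m Y)"
  shows "muCR m"
proof -
  interpret C: Metric_space "mspace (self_maps m)" "mdist (self_maps m)"
    by blast
  have self_maps_eq: "mspace (self_maps n) = {f. f \<in> mspace n \<rightarrow> mspace n \<and>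
      f \<in> extensional (mspace n) \<and> continuous_map (mtopology_of n) (mtopology_of n) f}"
    if "compact_space (mtopology_of n)" for n :: "'a metric"
    using compactin_mspace_cfunspace[of "mtopology_of n" n] that
    by (auto simp: compact_space_def)
  have dense: "mtopology_of (self_maps m) closure_of
      {f \<in> mspace (self_maps m). chain_recurrent_set m f \<in> null_sets M} = mspace (self_maps m)"
    if M: "finite_borel_measure_on m M" and atomless: "atomless M" for M
  proof -
    let ?G = "{f \<in> mspace (self_maps m). chain_recurrent_set m f \<in> null_sets M}"
    have "\<exists>g\<in>?G. g \<in> C.mball f \<epsilon>" if f: "f \<in> mspace (self_maps m)" and "\<epsilon> > 0" for f \<epsilon>
    proof -
      have f_cont: "continuous_map (mtopology_of m) (mtopology_of m) f"
        and f_maps: "f \<in> mspace m \<rightarrow> mspace m"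
        using f by auto
      have "uniformly_continuous_map m m f" "\<epsilon>/4 > 0"
        using continuous_imp_uniformly_continuous_map assms(1) f_cont \<open>\<epsilon> > 0\<close> by auto
      then obtain \<delta> where "\<delta> > 0" and \<delta>0: "\<forall>a\<in>mspace m. \<forall>b\<in>mspace m.
          mdist m a b < \<delta> \<longrightarrow> mdist m (f a) (f b) < \<epsilon>/4"
        by (rule uniformly_continuous_mapE)
      note \<delta> = \<delta>0[rule_format]
      obtain Y r where retr: "retraction_onto m Y r" and Yr: "Y = r ` mspace m"
        and near: "mdist (self_maps m) (restrict r (mspace m)) (restrict id (mspace m)) < min \<delta> (\<epsilon>/4)"
        and muCR_Y: "muCR (submetric m Y)"
        using assms(2)[of "min \<delta> (\<epsilon>/4)"] \<open>\<delta> > 0\<close> \<open>\<epsilon> > 0\<close> by auto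
      let ?Y = "submetric m Y"
      have Ym: "Y \<subseteq> mspace m" and r_contY: "continuous_map (mtopology_of m) (mtopology_of ?Y) r"
        and fix_Y: "\<And>y. y \<in> Y \<Longrightarrow> r y = y"
        using retr by (auto simp: retraction_onto_def)
      have mspace_Y: "mspace ?Y = Y"
        using Ym by auto
      have r_cont: "continuous_map (mtopology_of m) (mtopology_of m) r"
        and rY: "r \<in> mspace m \<rightarrow> Y"
        using r_contY by (auto simp: mtopology_of_submetric continuous_map_in_subtopology)
      have rm: "r x \<in> mspace m" if "x \<in> mspace m" for x
        using that rY Ym by auto
      have compact_Y: "compact_space (mtopology_of ?Y)"
        using muCR_Y by (simp add: muCR_def)
      then have "compactin (mtopology_of m) Y"
        using Ym by (simp add: mtopology_of_submetric compactin_subspace)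
      then have Y: "closedin (mtopology_of m) Y"
        using Metric_space.Hausdorff_space_mtopology[OF Metric_space_mspace_mdist[of m]]
        by (auto simp: mtopology_of_def intro: compactin_imp_closedin)
      have near_id: "mdist m (r x) x < min \<delta> (\<epsilon>/4)" if "x \<in> mspace m" for x
      proof -
        have "restrict r (mspace m) \<in> mspace (self_maps m)"
          using r_cont rm unfolding self_maps_eq[OF assms(1)] by simp
        moreover have "restrict id (mspace m) \<in> mspace (self_maps m)"
          unfolding self_maps_eq[OF assms(1)] by simp
        ultimately have "mdist m (restrict r (mspace m) x) (restrict id (mspace m) x) < min \<delta> (\<epsilon>/4)"
          using that
          by (intro cfunspace_mdist_lt[OF assms(1)[unfolded compact_space_def] _ _ near])
            (simp_all only: topspace_mtopology_of)
        then show ?thesis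
          using that by simp
      qed
      define h where "h = restrict (r \<circ> f) Y"
      have "continuous_map (mtopology_of ?Y) (mtopology_of m) f"
        unfolding mtopology_of_submetric using f_cont by (rule continuous_map_from_subtopology)
      then have "continuous_map (mtopology_of ?Y) (mtopology_of ?Y) (r \<circ> f)"
        using r_contY by (rule continuous_map_compose)
      then have "continuous_map (mtopology_of ?Y) (mtopology_of ?Y) h"
        by (simp add: h_def)
      moreover have "h \<in> Y \<rightarrow> Y"
        using f_maps rY Ym by (auto simp: h_def Pi_iff subset_iff)
      ultimately have h: "h \<in> mspace (self_maps ?Y)"
        unfolding self_maps_eq[OF compact_Y] mspace_Y by (simp add: h_def)
      \<comment> \<open>Restricting, rather than pushing forward, is essential here: the image of \<open>M\<close> under \<open>r\<close>
        has atoms when \<open>r\<close> collapses a set of positive measure to a point.\<close>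
      define N where "N = restrict_space M Y"
      have N: "finite_borel_measure_on ?Y N" "atomless N"
        unfolding N_def using M Y atomless sets_of_closedin[OF M Y]
        by (auto intro: finite_borel_measure_on_restrict_space atomless_restrict_space)
      have "mtopology_of (self_maps ?Y) closure_of
          {f \<in> mspace (self_maps ?Y). chain_recurrent_set ?Y f \<in> null_sets N} = mspace (self_maps ?Y)"
        using muCR_Y N unfolding muCR_def Let_def topspace_mtopology_of by blast
      then have "h \<in> mtopology_of (self_maps ?Y) closure_of
          {f \<in> mspace (self_maps ?Y). chain_recurrent_set ?Y f \<in> null_sets N}"
        using h by (simp only:)
      then obtain k where k: "k \<in> mspace (self_maps ?Y)"
        and k_null: "chain_recurrent_set ?Y k \<in> null_sets N"
        and hk: "mdist (self_maps ?Y) h k < \<epsilon>/4"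
        using \<open>\<epsilon> > 0\<close>
        unfolding mtopology_of_eq[of "self_maps ?Y"]
          Metric_space.metric_closure_of[OF Metric_space_mspace_mdist]
          Metric_space.in_mball[OF Metric_space_mspace_mdist]
        by (smt (verit) divide_pos_pos mem_Collect_eq)
      have k_maps: "k \<in> Y \<rightarrow> Y" and k_cont: "continuous_map (mtopology_of ?Y) (mtopology_of ?Y) k"
        using k unfolding self_maps_eq[OF compact_Y] mspace_Y by auto
      define g where "g = restrict (k \<circ> r) (mspace m)"
      have "continuous_map (mtopology_of m) (mtopology_of ?Y) (k \<circ> r)"
        using r_contY k_cont by (rule continuous_map_compose)
      then have g_cont: "continuous_map (mtopology_of m) (mtopology_of m) g"
        by (simp add: g_def mtopology_of_submetric continuous_map_in_subtopology)
      have g_mem: "g \<in> mspace (self_maps m)"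
        using g_cont rY k_maps Ym unfolding self_maps_eq[OF assms(1)]
        by (auto simp: g_def Pi_iff subset_iff)
      have "chain_recurrent_set m g \<subseteq> chain_recurrent_set ?Y k"
        using assms(1) r_cont rY fix_Y Y k_maps
        by (intro chain_recurrent_set_comp_retraction[where r = r])
           (auto simp: g_def intro: continuous_imp_uniformly_continuous_map)
      moreover have "chain_recurrent_set ?Y k \<in> null_sets M"
        using k_null null_sets_restrict_space[OF sets_of_closedin[OF M Y]] by (auto simp: N_def)
      moreover have "chain_recurrent_set m g \<in> sets M"
        unfolding chain_recurrent_set_eq_INT
        using sets_of_openin[OF M openin_chain_loops[OF g_cont]] by auto
      ultimately have g_null: "chain_recurrent_set m g \<in> null_sets M"
        using null_sets_subset by blast
      \<comment> \<open>One \<open>\<epsilon>/4\<close> each for moving from \<open>x\<close> to \<open>r x\<close> inside \<open>f\<close>, for applying \<open>r\<close> to the value,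
        and for replacing \<open>r \<circ> f\<close> by \<open>k\<close> on \<open>Y\<close>.\<close>
      have "mdist m (f x) (g x) \<le> 3 * \<epsilon>/4" if x: "x \<in> mspace m" for x
      proof -
        define y where "y = r x"
        have y: "y \<in> Y" "y \<in> mspace m"
          using rY rm x by (auto simp: y_def)
        have fx: "f x \<in> mspace m" and fy: "f y \<in> mspace m" and rfy: "r (f y) \<in> mspace m"
          and ky: "k y \<in> mspace m"
          using f_maps rm x y k_maps Ym by (auto simp: Pi_iff subset_iff)
        have "mdist m (f x) (k y) \<le> mdist m (f x) (f y) + mdist m (f y) (k y)"
          using fx fy ky by (rule mdist_triangle)
        moreover have "mdist m (f y) (k y) \<le> mdist m (f y) (r (f y)) + mdist m (r (f y)) (k y)"
          using fy rfy ky by (rule mdist_triangle)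
        moreover have "mdist m (f x) (f y) < \<epsilon>/4"
          using \<delta>[OF x y(2)] near_id[OF x] by (simp add: y_def mdist_commute)
        moreover have "mdist m (f y) (r (f y)) < \<epsilon>/4"
          using near_id[OF fy] by (simp add: mdist_commute)
        moreover have "mdist m (r (f y)) (k y) \<le> \<epsilon>/4"
          using mdist_cfunspace_imp_mdist_le[OF h k less_imp_le[OF hk], of y] y by (simp add: h_def)
        ultimately show ?thesis
          using x by (simp add: g_def y_def)
      qed
      then have "mdist (self_maps m) f g \<le> 3 * \<epsilon>/4"
        using \<open>\<epsilon> > 0\<close> by (intro mdist_cfunspace_le) auto
      then have "mdist (self_maps m) f g < \<epsilon>"
        using \<open>\<epsilon> > 0\<close> by linarith
      then show ?thesis
        unfolding C.in_mball using f g_mem g_null by blast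
    qed
    then show ?thesis
      unfolding mtopology_of_eq[of "self_maps m"] C.metric_closure_of by blast
  qed
  show ?thesis
    unfolding muCR_def Let_def topspace_mtopology_of
    using assms(1) gdelta_in_chain_recurrent_null dense by blast
qed

end
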